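(* The function $r(z)$ is holomorphic in the strip $1<\operatorname{Re}(z)<3/2$, and for $z=x+iy$ in this strip and every $j\in\mathbb R$, $$\operatorname{Re}\left(r(z)+\frac{\pi i j}{z}\right)\leqslant \frac{1}{2\pi|z|^2}\left(x\operatorname{Cl}_2(2\pi x)+\pi^2|y|\left[\frac13+2(j+1)\right]\right)\quad (y\geqslant0),$$ $$\operatorname{Re}\left(r(z)+\frac{\pi i j}{z}\right)\leqslant \frac{1}{2\pi|z|^2}\left(x\operatorname{Cl}_2(2\pi x)+\pi^2|y|\left[\frac13-2j\right]\right)\quad (y\leqslant0).$$
   Context: $\operatorname{Li}_2$ is the principal branch of the dilogarithm (holomorphic on $\mathbb C\setminus[1,\infty)$). $r(z):=\dfrac{\operatorname{Li}_2(e^{2\pi i z})}{2\pi i z}+\dfrac{13\pi i}{12 z}$ for $1<\operatorname{Re}(z)<2$. $\operatorname{Cl}_2(\theta):=-\int_0^\theta\log|2\sin(x/2)|\,dx$ is Clausen's integral. *)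

theory Defs
  imports "HOL-Complex_Analysis.Complex_Analysis"
begin

text \<open>
  Principal branch of the dilogarithm,
  \<open>Li\<^sub>2(z) = - \<integral>\<^sub>0\<^sup>z Log(1 - u) / u du\<close> along the segment from \<open>0\<close> to \<open>z\<close>, with the
  principal logarithm. For \<open>z\<close> off the cut \<open>[1, \<infinity>)\<close> the segment avoids the cut as well.
  The singularity of the integrand at \<open>u = 0\<close> is removable, and its value there does not
  affect the integral. No meaning is attached to values on the cut.
\<close>

definition dilog :: "complex \<Rightarrow> complex" where
  "dilog z = - contour_integral (linepath 0 z) (\<lambda>u. Ln (1 - u) / u)"

text \<open>
  The integral is oriented, so negative \<open>\<theta>\<close> is covered. The logarithmic singularities at
  multiples of \<open>2\<pi>\<close> (where the library has \<open>ln 0 = 0\<close>) are integrable and form a null set.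
\<close>

definition clausen :: "real \<Rightarrow> real" where
  "clausen \<theta> = - (LBINT x=0..ereal \<theta>. ln \<bar>2 * sin (x / 2)\<bar>)"

text \<open>Only meaningful for \<open>1 < Re z < 2\<close>, where \<open>exp (2\<pi>iz)\<close> stays off the cut.\<close>

definition r :: "complex \<Rightarrow> complex" where
  "r z = dilog (exp (2 * of_real pi * \<i> * z)) / (2 * of_real pi * \<i> * z)
         + 13 * of_real pi * \<i> / (12 * z)"

end

theory Submission
  imports Defs "HOL-Real_Asymp.Real_Asymp"
begin

text \<open>
  Put \<open>w = exp (2\<pi>iz) = t e\<^sup>i\<^sup>\<theta>\<close> with \<open>t = exp (-2\<pi>y)\<close> and \<open>\<theta> = 2\<pi>(x - 1) \<in> (0, \<pi>)\<close>. Multiplying out,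
  \<open>2\<pi>|z|\<^sup>2\<close> times the real part in question is
  \<open>x Im Li\<^sub>2(w) - y Re Li\<^sub>2(w) + \<pi>\<^sup>2y(13/6 + 2j)\<close>. The derivative of \<open>Li\<^sub>2\<close> along the ray
  is \<open>-Log(1 - t e\<^sup>i\<^sup>\<theta>)/t\<close>, and \<open>arg(1 - t e\<^sup>i\<^sup>\<theta>)\<close> lies in \<open>(\<theta> - \<pi>, 0)\<close>. So \<open>Im Li\<^sub>2(t e\<^sup>i\<^sup>\<theta>)\<close> increases
  with \<open>t\<close>, by at most \<open>(\<pi> - \<theta>) ln t\<close> after \<open>t = 1\<close>, where its value is \<open>Cl\<^sub>2(\<theta>)\<close>. For the real
  part the crude bounds \<open>Re Li\<^sub>2 \<ge> -1 \<ge> -\<pi>\<^sup>2/6\<close> for \<open>t \<le> 1\<close> and \<open>Re Li\<^sub>2 \<le> 3 \<le> \<pi>\<^sup>2/2\<close> for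
  \<open>t \<ge> 1\<close> suffice.
\<close>

section \<open>The dilogarithm off its cut\<close>

lemma starlike_dilog_domain: "closed_segment 0 w \<subseteq> {u::complex. 1 - u \<notin> \<real>\<^sub>\<le>\<^sub>0}"
  if "1 - w \<notin> \<real>\<^sub>\<le>\<^sub>0"
proof
  fix v assume "v \<in> closed_segment 0 w"
  then obtain c where c: "0 \<le> c" "c \<le> 1" "v = of_real c * w"
    by (auto simp: closed_segment_def scaleR_conv_of_real)
  have "Im w \<noteq> 0 \<or> Re w < 1"
    using that by (auto simp: complex_nonpos_Reals_iff)
  moreover have "c * Re w < 1" if "Re w < 1"
  proof (cases "Re w \<ge> 0")
    case True
    then show ?thesis
      using c that mult_left_le_one_le[of "Re w" c] by simp
  next
    case False
    then show ?thesis
      using c mult_nonneg_nonpos[of c "Re w"] by simp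
  qed
  ultimately show "v \<in> {u. 1 - u \<notin> \<real>\<^sub>\<le>\<^sub>0}"
    using c by (auto simp: complex_nonpos_Reals_iff)
qed

lemma open_dilog_domain: "open {u::complex. 1 - u \<notin> \<real>\<^sub>\<le>\<^sub>0}"
proof -
  have "closed ((\<lambda>u::complex. 1 - u) -` \<real>\<^sub>\<le>\<^sub>0)"
    by (intro continuous_closed_vimage closed_nonpos_Reals_complex continuous_intros)
  then show ?thesis
    by (simp add: closed_def vimage_def Compl_eq)
qed

text \<open>\<open>Ln (1 - u) / u\<close> has a removable singularity at 0 with value -1. The
  extension \<open>k\<close> is holomorphic on a domain starlike about 0, so it has a primitive
  \<open>g\<close> there, and \<open>dilog v = g 0 - g v\<close>.\<close>

lemma has_field_derivative_dilog:
  assumes "1 - w \<notin> \<real>\<^sub>\<le>\<^sub>0"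
  shows "(dilog has_field_derivative (if w = 0 then 1 else - (Ln (1 - w) / w))) (at w)"
proof -
  define S where "S = {u::complex. 1 - u \<notin> \<real>\<^sub>\<le>\<^sub>0}"
  define k where "k = (\<lambda>u::complex. if u = 0 then - 1 else Ln (1 - u) / u)"
  have S: "open S" "starlike S" "0 \<in> S" "w \<in> S"
    using open_dilog_domain starlike_dilog_domain assms by (auto simp: S_def starlike_def)
  have "(\<lambda>u. Ln (1 - u)) holomorphic_on S"
    by (auto simp: S_def intro!: holomorphic_intros)
  moreover have "deriv (\<lambda>u. Ln (1 - u)) 0 = -1"
    by (rule DERIV_imp_deriv) (auto intro!: derivative_eq_intros)
  ultimately have k: "k holomorphic_on S"
    using pole_lemma_open[of "\<lambda>u. Ln (1 - u)" S 0] S(1)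
    by (simp add: k_def cong: if_cong)
  then obtain g where g: "\<And>x. x \<in> S \<Longrightarrow> (g has_field_derivative k x) (at x)"
    using holomorphic_starlike_primitive[of S k "{}"] S(1,2)
    by (auto simp: holomorphic_on_imp_continuous_on holomorphic_on_imp_differentiable_at)
  have eq: "g 0 - g v = dilog v" if "v \<in> S" for v
  proof -
    have "(k has_contour_integral (g v - g 0)) (linepath 0 v)"
      using contour_integral_primitive[of S g k "linepath 0 v"] g starlike_dilog_domain[of v] that
      by (auto simp: S_def has_field_derivative_at_within)
    then have "((\<lambda>u. Ln (1 - u) / u) has_contour_integral (g v - g 0)) (linepath 0 v)"
      unfolding has_contour_integral_linepath
    \<comment> \<open>For \<open>v \<noteq> 0\<close> the segment meets 0 only at parameter 0, so
      the two integrands differ at one point; for \<open>v = 0\<close> the path is constant.\<close>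
    proof (cases "v = 0", goal_cases)
      case 2
      then show ?case
        by (subst has_integral_spike_finite_eq[where S = "{0}" and g = "\<lambda>x. k (linepath 0 v x) * (v - 0)"])
          (auto simp: k_def linepath_def)
    qed auto
    then show ?thesis
      by (simp add: dilog_def contour_integral_unique)
  qed
  have "((\<lambda>v. g 0 - g v) has_field_derivative - k w) (at w)"
    using g[OF S(4)] by (auto intro!: derivative_eq_intros)
  then have "(dilog has_field_derivative - k w) (at w)"
    using eq S(1,4) by (subst DERIV_cong_ev[OF refl _ refl, where g = "\<lambda>v. g 0 - g v"])
      (auto simp: eventually_nhds intro!: exI[of _ S])
  then show ?thesis
    by (simp add: k_def if_distrib cong: if_cong)
qed

lemma dilog_0 [simp]: "dilog 0 = 0"
  by (simp add: dilog_def)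

lemma holomorphic_dilog: "dilog holomorphic_on {u. 1 - u \<notin> \<real>\<^sub>\<le>\<^sub>0}"
  unfolding holomorphic_on_open[OF open_dilog_domain]
  using has_field_derivative_dilog by blast

lemma holomorphic_on_dilog [holomorphic_intros]:
  assumes "f holomorphic_on A" and "\<And>z. z \<in> A \<Longrightarrow> 1 - f z \<notin> \<real>\<^sub>\<le>\<^sub>0"
  shows "(\<lambda>z. dilog (f z)) holomorphic_on A"
  using holomorphic_on_compose_gen[OF assms(1) holomorphic_dilog] assms(2) by (auto simp: o_def)

text \<open>The factor \<open>cis \<theta>\<close> from the chain rule cancels against the
  denominator and leaves the real number \<open>t\<close>. Real and imaginary parts of the
  derivative are thus governed by modulus and argument of \<open>1 - t cis \<theta>\<close>.\<close>

lemma has_vector_derivative_dilog_radial: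
  assumes "1 - of_real t * cis \<theta> \<notin> \<real>\<^sub>\<le>\<^sub>0" and "t \<noteq> 0"
  shows "((\<lambda>t. dilog (of_real t * cis \<theta>)) has_vector_derivative
           - (Ln (1 - of_real t * cis \<theta>) / of_real t)) (at t)"
proof -
  have "((\<lambda>t. of_real t * cis \<theta>) has_vector_derivative cis \<theta>) (at t)"
    by (auto intro!: derivative_eq_intros)
  from field_vector_diff_chain_at[OF this has_field_derivative_dilog[OF assms(1)]]
  show ?thesis
    using assms(2) by (simp add: o_def)
qed

lemma continuous_on_dilog_radial:
  assumes "\<And>t. t \<in> A \<Longrightarrow> 1 - of_real t * cis \<theta> \<notin> \<real>\<^sub>\<le>\<^sub>0"
  shows "continuous_on A (\<lambda>t. dilog (of_real t * cis \<theta>))"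
  by (rule continuous_on_compose2[OF holomorphic_on_imp_continuous_on[OF holomorphic_dilog]])
    (use assms in \<open>auto intro!: continuous_on_mult continuous_on_of_real continuous_on_id continuous_on_const\<close>)

lemma cmod_one_minus_polar:
  "(cmod (1 - of_real t * cis \<phi>))\<^sup>2 = (1 - t)\<^sup>2 + 4 * t * (sin (\<phi> / 2))\<^sup>2"
proof -
  have "(cmod (1 - of_real t * cis \<phi>))\<^sup>2 = (1 - t * cos \<phi>)\<^sup>2 + (t * sin \<phi>)\<^sup>2"
    by (simp add: cmod_power2)
  also have "\<dots> = 1 - 2 * t * cos \<phi> + t\<^sup>2 * ((sin \<phi>)\<^sup>2 + (cos \<phi>)\<^sup>2)"
    by (simp add: power2_eq_square algebra_simps del: sin_cos_squared_add sin_cos_squared_add2 sin_cos_squared_add3)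
  also have "\<dots> = 1 - 2 * t * cos \<phi> + t\<^sup>2"
    by simp
  also have "cos \<phi> = 1 - 2 * (sin (\<phi> / 2))\<^sup>2"
    using cos_double_sin[of "\<phi> / 2"] by simp
  finally show ?thesis
    by (simp add: power2_eq_square algebra_simps)
qed

section \<open>Radial bounds in the upper half plane\<close>

context
  fixes \<theta> :: real
  assumes \<theta>: "0 < \<theta>" "\<theta> < pi"
begin

lemma one_minus_polar_notin_nonpos_Reals: "0 \<le> t \<Longrightarrow> 1 - of_real t * cis \<theta> \<notin> \<real>\<^sub>\<le>\<^sub>0"
  using sin_gt_zero[OF \<theta>] by (auto simp: complex_nonpos_Reals_iff)

lemma has_real_derivative_Re_dilog_radial:
  assumes "0 < t"
  shows "((\<lambda>t. Re (dilog (of_real t * cis \<theta>))) has_real_derivative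
           - (ln (cmod (1 - of_real t * cis \<theta>)) / t)) (at t)"
proof -
  have *: "1 - of_real t * cis \<theta> \<notin> \<real>\<^sub>\<le>\<^sub>0"
    using assms by (intro one_minus_polar_notin_nonpos_Reals) simp
  then have "1 - of_real t * cis \<theta> \<noteq> 0"
    by (metis nonpos_Reals_zero_I)
  then show ?thesis
    using bounded_linear.has_vector_derivative[OF bounded_linear_Re
        has_vector_derivative_dilog_radial[OF *]] assms
    by (simp add: has_real_derivative_iff_has_vector_derivative)
qed

lemma has_real_derivative_Im_dilog_radial:
  assumes "0 < t"
  shows "((\<lambda>t. Im (dilog (of_real t * cis \<theta>))) has_real_derivative
           - (Im (Ln (1 - of_real t * cis \<theta>)) / t)) (at t)"
proof -
  have *: "1 - of_real t * cis \<theta> \<notin> \<real>\<^sub>\<le>\<^sub>0"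
    using assms by (intro one_minus_polar_notin_nonpos_Reals) simp
  then show ?thesis
    using bounded_linear.has_vector_derivative[OF bounded_linear_Im
        has_vector_derivative_dilog_radial[OF *]] assms
    by (simp add: has_real_derivative_iff_has_vector_derivative)
qed

lemma continuous_on_Re_dilog_radial:
  "0 \<le> a \<Longrightarrow> continuous_on {a..b} (\<lambda>t. Re (dilog (of_real t * cis \<theta>)))"
  by (intro continuous_on_Re continuous_on_dilog_radial one_minus_polar_notin_nonpos_Reals) auto

lemma continuous_on_Im_dilog_radial:
  "0 \<le> a \<Longrightarrow> continuous_on {a..b} (\<lambda>t. Im (dilog (of_real t * cis \<theta>)))"
  by (intro continuous_on_Im continuous_on_dilog_radial one_minus_polar_notin_nonpos_Reals) auto

text \<open>The point lies in the lower half plane, hence the upper bound. Rotation by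
  \<open>pi - \<theta>\<close> turns it into \<open>cis (pi - \<theta>) + t\<close>, which lies in
  the upper half plane, hence the lower bound.\<close>

lemma Im_Ln_one_minus_polar:
  assumes "0 < t"
  shows "\<theta> - pi < Im (Ln (1 - of_real t * cis \<theta>))" "Im (Ln (1 - of_real t * cis \<theta>)) < 0"
proof -
  define v where "v = 1 - of_real t * cis \<theta>"
  define \<alpha> where "\<alpha> = Im (Ln v)"
  have "Im v < 0"
    using sin_gt_zero[OF \<theta>] assms by (simp add: v_def)
  then have v: "v \<noteq> 0"
    by auto
  show neg: "Im (Ln (1 - of_real t * cis \<theta>)) < 0"
    using Im_Ln_pos_le[OF v] Im_Ln_le_pi[OF v] \<open>Im v < 0\<close> unfolding v_def by linarith
  have "-pi < \<alpha>" "\<alpha> < 0"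
    using mpi_less_Im_Ln[OF v] neg by (auto simp: \<alpha>_def v_def)
  have "v = of_real (cmod v) * cis \<alpha>"
    using exp_eq_polar[of "Ln v"] v by (simp add: \<alpha>_def exp_of_real)
  then have "v * cis (pi - \<theta>) = of_real (cmod v) * cis (\<alpha> + (pi - \<theta>))"
    by (metis cis_mult mult.assoc)
  moreover have "v * cis (pi - \<theta>) = cis (pi - \<theta>) + of_real t"
    by (simp add: v_def left_diff_distrib cis_mult mult.assoc)
  ultimately have "Im (of_real (cmod v) * cis (\<alpha> + (pi - \<theta>))) = Im (cis (pi - \<theta>) + of_real t)"
    by simp
  then have "cmod v * sin (\<alpha> + (pi - \<theta>)) = sin (pi - \<theta>)"
    by simp
  also have "\<dots> > 0"
    using sin_gt_zero[OF \<theta>] by simp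
  finally have "0 < sin (\<alpha> + (pi - \<theta>))"
    using v by (simp add: zero_less_mult_iff)
  \<comment> \<open>The rotated angle exceeds \<open>- \<theta> > - pi\<close>, and its sine would
    be nonpositive on \<open>(- pi, 0]\<close>.\<close>
  then have "0 < \<alpha> + (pi - \<theta>)"
    using sin_ge_zero[of "- (\<alpha> + (pi - \<theta>))"] sin_minus[of "\<alpha> + (pi - \<theta>)"] \<open>-pi < \<alpha>\<close> \<theta>
    by linarith
  then show "\<theta> - pi < Im (Ln (1 - of_real t * cis \<theta>))"
    by (simp add: \<alpha>_def v_def)
qed

lemma Im_dilog_radial_mono:
  assumes "0 \<le> s" "s \<le> t"
  shows "Im (dilog (of_real s * cis \<theta>)) \<le> Im (dilog (of_real t * cis \<theta>))"
\<comment> \<open>The open form of the criterion admits \<open>s = 0\<close>, where continuity is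
  available but the derivative formula is not.\<close>
proof (rule DERIV_nonneg_imp_increasing_open[OF assms(2)])
  fix u assume "s < u"
  then have "0 < u"
    using assms(1) by simp
  then have "0 \<le> - (Im (Ln (1 - of_real u * cis \<theta>)) / u)"
    using Im_Ln_one_minus_polar(2)[of u] by (simp add: divide_le_0_iff)
  then show "\<exists>y. ((\<lambda>t. Im (dilog (of_real t * cis \<theta>))) has_real_derivative y) (at u) \<and> 0 \<le> y"
    using has_real_derivative_Im_dilog_radial[OF \<open>0 < u\<close>] by blast
qed (use assms in \<open>simp add: continuous_on_Im_dilog_radial\<close>)

lemma Im_dilog_radial_le:
  assumes "1 \<le> t"
  shows "Im (dilog (of_real t * cis \<theta>)) \<le> Im (dilog (cis \<theta>)) + (pi - \<theta>) * ln t"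
proof -
  have "Im (dilog (of_real t * cis \<theta>)) - (pi - \<theta>) * ln t
      \<le> Im (dilog (of_real 1 * cis \<theta>)) - (pi - \<theta>) * ln 1"
  proof (rule DERIV_nonpos_imp_nonincreasing[OF assms])
    fix u :: real assume u: "1 \<le> u"
    have "((\<lambda>t. Im (dilog (of_real t * cis \<theta>)) - (pi - \<theta>) * ln t) has_real_derivative
            - (Im (Ln (1 - of_real u * cis \<theta>)) / u) - (pi - \<theta>) * (1 / u)) (at u)"
      using u by (intro derivative_intros has_real_derivative_Im_dilog_radial)
        (auto intro!: derivative_eq_intros)
    moreover have "- (Im (Ln (1 - of_real u * cis \<theta>)) / u) - (pi - \<theta>) * (1 / u) \<le> 0"
      using Im_Ln_one_minus_polar(1)[of u] u by (simp add: field_simps)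
    ultimately show "\<exists>y. ((\<lambda>t. Im (dilog (of_real t * cis \<theta>)) - (pi - \<theta>) * ln t)
        has_real_derivative y) (at u) \<and> y \<le> 0"
      by blast
  qed
  then show ?thesis
    by simp
qed

text \<open>Adding \<open>t\<close> makes the real part increasing from its value 0 at the origin,
  because \<open>ln |v| \<le> |v| - 1\<close> with \<open>v = 1 - u cis \<theta>\<close> and
  \<open>|v| \<le> 1 + u\<close>.\<close>

lemma Re_dilog_radial_ge:
  assumes "0 \<le> t"
  shows "- t \<le> Re (dilog (of_real t * cis \<theta>))"
proof -
  have "Re (dilog (of_real 0 * cis \<theta>)) + 0 \<le> Re (dilog (of_real t * cis \<theta>)) + t"
  proof (rule DERIV_nonneg_imp_increasing_open[OF assms])
    fix u :: real assume u: "0 < u"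
    have "((\<lambda>t. Re (dilog (of_real t * cis \<theta>)) + t) has_real_derivative
            - (ln (cmod (1 - of_real u * cis \<theta>)) / u) + 1) (at u)"
      using u by (intro derivative_intros has_real_derivative_Re_dilog_radial)
    moreover have "ln (cmod (1 - of_real u * cis \<theta>)) \<le> u"
    proof -
      have "1 - of_real u * cis \<theta> \<noteq> 0"
        using one_minus_polar_notin_nonpos_Reals[of u] u by (metis less_imp_le nonpos_Reals_zero_I)
      then have "ln (cmod (1 - of_real u * cis \<theta>)) \<le> cmod (1 - of_real u * cis \<theta>) - 1"
        by (intro ln_le_minus_one) simp
      also have "\<dots> \<le> u"
        using norm_triangle_ineq4[of 1 "of_real u * cis \<theta>"] u by (simp add: norm_mult)
      finally show ?thesis .
    qed
    then have "0 \<le> - (ln (cmod (1 - of_real u * cis \<theta>)) / u) + 1"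
      using u by (simp add: field_simps)
    ultimately show "\<exists>y. ((\<lambda>t. Re (dilog (of_real t * cis \<theta>)) + t) has_real_derivative y) (at u)
        \<and> 0 \<le> y"
      by blast
  qed (use assms in \<open>intro continuous_intros continuous_on_Re_dilog_radial; simp\<close>)
  then show ?thesis
    by simp
qed

text \<open>A comparison principle with majorants independent of \<open>\<theta>\<close>: since
  \<open>|1 - u cis \<theta>| \<ge> |1 - u|\<close>, the radial derivative is at most
  \<open>- ln |1 - u| / u\<close>. At the endpoints \<open>K\<close> is only continuous, so the
  interval may begin or end at the singularity 1.\<close>

lemma Re_dilog_radial_le_aux:
  assumes "0 \<le> a" "a \<le> b"
    and K: "\<And>u. a < u \<Longrightarrow> u < b \<Longrightarrow> (K has_real_derivative K' u) (at u)"
    and K': "\<And>u. a < u \<Longrightarrow> u < b \<Longrightarrow> - (ln \<bar>1 - u\<bar> / u) \<le> K' u"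
    and cont: "continuous_on {a..b} K" and "1 \<notin> {a<..<b}"
  shows "Re (dilog (of_real b * cis \<theta>)) - Re (dilog (of_real a * cis \<theta>)) \<le> K b - K a"
proof -
  have "Re (dilog (of_real b * cis \<theta>)) - K b \<le> Re (dilog (of_real a * cis \<theta>)) - K a"
  proof (rule DERIV_nonpos_imp_decreasing_open[OF assms(2)])
    fix u assume u: "a < u" "u < b"
    then have "0 < u" "u \<noteq> 1"
      using assms(1,6) by auto
    have "((\<lambda>t. Re (dilog (of_real t * cis \<theta>)) - K t) has_real_derivative
            - (ln (cmod (1 - of_real u * cis \<theta>)) / u) - K' u) (at u)"
      using u \<open>0 < u\<close> by (intro derivative_intros has_real_derivative_Re_dilog_radial K)
    moreover have "\<bar>1 - u\<bar> \<le> cmod (1 - of_real u * cis \<theta>)"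
      using norm_triangle_ineq3[of 1 "of_real u * cis \<theta>"] \<open>0 < u\<close> by (simp add: norm_mult)
    then have "ln \<bar>1 - u\<bar> / u \<le> ln (cmod (1 - of_real u * cis \<theta>)) / u"
      using \<open>0 < u\<close> \<open>u \<noteq> 1\<close> by (intro divide_right_mono) (auto intro!: ln_mono)
    then have "- (ln (cmod (1 - of_real u * cis \<theta>)) / u) - K' u \<le> 0"
      using K'[OF u] by simp
    ultimately show "\<exists>y. ((\<lambda>t. Re (dilog (of_real t * cis \<theta>)) - K t) has_real_derivative y) (at u)
        \<and> y \<le> 0"
      by blast
  qed (use assms in \<open>intro continuous_intros continuous_on_Re_dilog_radial; simp\<close>)
  then show ?thesis
    by simp
qed

end

text \<open>The convention \<open>ln 0 = 0\<close> gives the value at 0 that agrees with the limit.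
  This makes the primitives used below continuous up to \<open>t = 1\<close>.\<close>

lemma continuous_on_mult_ln: "continuous_on {0..} (\<lambda>x::real. x * ln x)"
proof -
  have "continuous (at x within {0..}) (\<lambda>x::real. x * ln x)" if "x \<ge> 0" for x :: real
  proof (cases "x = 0")
    case True
    have "((\<lambda>x::real. x * ln x) \<longlongrightarrow> 0) (at_right 0)"
      by real_asymp
    then have "((\<lambda>x::real. x * ln x) \<longlongrightarrow> 0) (at 0 within {0..})"
      by (simp add: at_within_Ici_at_right)
    then show ?thesis
      using True by (simp add: continuous_within)
  next
    case False
    then have "isCont (\<lambda>x. x * ln x) x"
      by (intro isCont_mult isCont_ln continuous_ident)
    then show ?thesis
      by (rule continuous_at_imp_continuous_at_within)
  qed
  then show ?thesis
    by (simp add: continuous_on_eq_continuous_within)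
qed

text \<open>Along the ray, \<open>|1 - t e\<^sup>i\<^sup>\<theta>|\<close> is at least \<open>|1 - t|\<close>; the resulting integrand
  \<open>-ln|1 - t| / t\<close> is at most \<open>1 - ln (1 - t)\<close> on \<open>(0, 1)\<close>, at most \<open>-ln (t - 1)\<close> on \<open>(1, 2)\<close>,
  and negative beyond \<open>2\<close>. The two majorants have integrals \<open>2\<close> and \<open>1\<close>.\<close>

lemma Re_dilog_radial_le:
  assumes \<theta>: "0 < \<theta>" "\<theta> < pi" and t: "1 \<le> t"
  shows "Re (dilog (of_real t * cis \<theta>)) \<le> 3"
proof -
  \<comment> \<open>If \<open>t \<le> 2\<close>, the last stretch from \<open>b\<close> to
    \<open>t\<close> is a single point, so no case distinction arises.\<close>
  define b where "b = min t 2"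
  have b: "1 \<le> b" "b \<le> 2" "b \<le> t"
    using t by (auto simp: b_def)
  have "Re (dilog (of_real 1 * cis \<theta>)) - Re (dilog (of_real 0 * cis \<theta>))
      \<le> (2 * 1 + (1 - 1) * ln (1 - 1)) - (2 * 0 + (1 - 0) * ln (1 - 0 :: real))"
  proof (rule Re_dilog_radial_le_aux[OF \<theta>, where K = "\<lambda>t. 2 * t + (1 - t) * ln (1 - t)"])
    fix u :: real assume u: "0 < u" "u < 1"
    show "((\<lambda>t. 2 * t + (1 - t) * ln (1 - t)) has_real_derivative 1 - ln (1 - u)) (at u)"
      using u by (auto intro!: derivative_eq_intros)
    \<comment> \<open>Cleared of denominators, the majorant inequality reads
      \<open>- (1 - u) * ln (1 - u) \<le> u\<close>.\<close>
    have "- ln (1 - u) \<le> 1 / (1 - u) - 1"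
      using ln_le_minus_one[of "1 / (1 - u)"] u by (simp add: ln_div)
    then have "- ln (1 - u) * (1 - u) \<le> (1 / (1 - u) - 1) * (1 - u)"
      by (rule mult_right_mono) (use u in simp)
    also have "\<dots> = u"
      using u by (simp add: field_simps)
    finally show "- (ln \<bar>1 - u\<bar> / u) \<le> 1 - ln (1 - u)"
      using u by (simp add: field_simps)
  next
    show "continuous_on {0..1} (\<lambda>t::real. 2 * t + (1 - t) * ln (1 - t))"
      by (intro continuous_on_add continuous_on_compose2[OF continuous_on_mult_ln])
        (auto intro!: continuous_intros)
  qed auto
  moreover have "Re (dilog (of_real b * cis \<theta>)) - Re (dilog (of_real 1 * cis \<theta>))
      \<le> ((b - 1) - (b - 1) * ln (b - 1)) - ((1 - 1) - (1 - 1) * ln (1 - 1))"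
  proof (rule Re_dilog_radial_le_aux[OF \<theta>, where K = "\<lambda>t. (t - 1) - (t - 1) * ln (t - 1)"])
    fix u :: real assume u: "1 < u" "u < b"
    show "((\<lambda>t. (t - 1) - (t - 1) * ln (t - 1)) has_real_derivative - ln (u - 1)) (at u)"
      using u by (auto intro!: derivative_eq_intros)
    have "ln (u - 1) \<le> 0"
      using u b by simp
    then have "ln (u - 1) * u \<le> ln (u - 1) * 1"
      using u by (intro mult_left_mono_neg) auto
    then show "- (ln \<bar>1 - u\<bar> / u) \<le> - ln (u - 1)"
      using u by (simp add: field_simps abs_minus_commute)
  next
    show "continuous_on {1..b} (\<lambda>t::real. (t - 1) - (t - 1) * ln (t - 1))"
      by (intro continuous_on_diff continuous_on_compose2[OF continuous_on_mult_ln])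
        (auto intro!: continuous_intros)
  qed (use b in auto)
  \<comment> \<open>With \<open>s = b - 1\<close>, this is \<open>s - s ln s \<le> 1\<close>,
    obtained from \<open>ln (1 / s) \<le> 1 / s - 1\<close>.\<close>
  moreover have "(b - 1) - (b - 1) * ln (b - 1) \<le> 1"
  proof (cases "b = 1")
    case False
    with b have "(b - 1) * (- ln (b - 1)) \<le> (b - 1) * (1 / (b - 1) - 1)"
      using ln_le_minus_one[of "1 / (b - 1)"] by (intro mult_left_mono) (auto simp: ln_div)
    also have "\<dots> = 1 - (b - 1)"
      using False by (simp add: field_simps)
    finally show ?thesis
      by simp
  qed simp
  moreover have "Re (dilog (of_real t * cis \<theta>)) - Re (dilog (of_real b * cis \<theta>)) \<le> 0 - 0"
  proof (rule Re_dilog_radial_le_aux[OF \<theta>, where K = "\<lambda>_. 0" and K' = "\<lambda>_. 0"])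
    fix u assume "b < u" "u < t"
    then have "2 < u"
      by (auto simp: b_def split: if_splits)
    then show "- (ln \<bar>1 - u\<bar> / u) \<le> 0"
      by (simp add: field_simps)
  qed (use b in auto)
  ultimately show ?thesis
    by simp
qed

section \<open>Boundary values and Clausen's integral\<close>

lemma one_minus_notin_nonpos_Reals:
  assumes "cmod w \<le> 1" "w \<noteq> 1"
  shows "1 - w \<notin> \<real>\<^sub>\<le>\<^sub>0"
proof
  assume "1 - w \<in> \<real>\<^sub>\<le>\<^sub>0"
  then have "Re w \<ge> 1" "Im w = 0"
    by (auto simp: complex_nonpos_Reals_iff)
  moreover have "Re w \<le> 1"
    using complex_Re_le_cmod[of w] assms(1) by linarith
  ultimately show False
    using assms(2) by (auto simp: complex_eq_iff)
qed

text \<open>Supplies the starting value for integration along circles: \<open>Ln (1 - t)\<close> is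
  real on \<open>[0, 1)\<close>, so the imaginary part stays constant along the ray of angle
  0.\<close>

lemma Im_dilog_of_real:
  assumes "0 \<le> \<rho>" "\<rho> < 1"
  shows "Im (dilog (of_real \<rho>)) = 0"
proof (cases "\<rho> = 0")
  case False
  have *: "1 - of_real t * cis 0 \<notin> \<real>\<^sub>\<le>\<^sub>0" if "0 \<le> t" "t \<le> \<rho>" for t
    using that assms by (auto simp: complex_nonpos_Reals_iff)
  have "Im (dilog (of_real \<rho> * cis 0)) = Im (dilog (of_real 0 * cis 0))"
  proof (rule DERIV_isconst_end[where f = "\<lambda>t. Im (dilog (of_real t * cis 0))"])
    fix t assume t: "0 < t" "t < \<rho>"
    have "Ln (1 - of_real t) = of_real (ln (1 - t))"
      using Ln_of_real[of "1 - t"] t assms by simp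
    then show "((\<lambda>t. Im (dilog (of_real t * cis 0))) has_real_derivative 0) (at t)"
      using bounded_linear.has_vector_derivative[OF bounded_linear_Im
          has_vector_derivative_dilog_radial[OF *[of t]]] t
      by (simp add: has_real_derivative_iff_has_vector_derivative)
  qed (use assms False * in \<open>auto intro!: continuous_on_Im continuous_on_dilog_radial simp del: cis_zero\<close>)
  then show ?thesis
    by simp
qed auto

lemma continuous_on_ln_cmod_one_minus_polar:
  assumes "0 < \<rho>" "\<rho> < 1"
  shows "continuous_on A (\<lambda>\<phi>. ln (cmod (1 - of_real \<rho> * cis \<phi>)))"
proof (intro continuous_intros ballI)
  fix \<phi>
  have "cmod (of_real \<rho> * cis \<phi>) < 1"
    using assms by (simp add: norm_mult)
  then show "cmod (1 - of_real \<rho> * cis \<phi>) \<noteq> 0"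
    by auto
qed

text \<open>Along the circle \<open>w = \<rho> cis \<phi>\<close> the derivative of \<open>w\<close>
  is \<open>\<i> * w\<close>, so that of \<open>dilog\<close> is \<open>- \<i> * Ln (1 - w)\<close>,
  with imaginary part \<open>- ln |1 - w|\<close>. The fundamental theorem of calculus applies
  because \<open>\<rho> < 1\<close> keeps \<open>w\<close> off the cut.\<close>

lemma Im_dilog_eq_integral:
  assumes \<rho>: "0 < \<rho>" "\<rho> < 1" and "0 \<le> \<theta>"
  shows "(LBINT \<phi>=0..\<theta>. ln (cmod (1 - of_real \<rho> * cis \<phi>))) = - Im (dilog (of_real \<rho> * cis \<theta>))"
proof -
  have "(LBINT \<phi>=ereal 0..ereal \<theta>. ln (cmod (1 - of_real \<rho> * cis \<phi>)))
      = - Im (dilog (of_real \<rho> * cis \<theta>)) - - Im (dilog (of_real \<rho> * cis 0))"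
  proof (rule interval_integral_FTC_finite)
    fix \<phi> :: real
    define w where "w = of_real \<rho> * cis \<phi>"
    have "cmod w < 1"
      using \<rho> by (simp add: w_def norm_mult)
    then have "w \<noteq> 1"
      by auto
    then have w: "1 - w \<notin> \<real>\<^sub>\<le>\<^sub>0" "1 - w \<noteq> 0" "w \<noteq> 0"
      using \<rho> \<open>cmod w < 1\<close> one_minus_notin_nonpos_Reals[of w] by (auto simp: w_def)
    have "((\<lambda>\<phi>. of_real \<rho> * cis \<phi>) has_vector_derivative \<i> * w) (at \<phi>)"
      unfolding w_def cis_conv_exp by (auto intro!: derivative_eq_intros has_vector_derivative_real_field)
    from field_vector_diff_chain_at[OF this[unfolded w_def] has_field_derivative_dilog] w
    have "((\<lambda>\<phi>. dilog (of_real \<rho> * cis \<phi>)) has_vector_derivative - \<i> * Ln (1 - w)) (at \<phi>)"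
      by (simp add: o_def w_def)
    from bounded_linear.has_vector_derivative[OF bounded_linear_Im this]
    have "((\<lambda>\<phi>. Im (dilog (of_real \<rho> * cis \<phi>))) has_vector_derivative - ln (cmod (1 - w))) (at \<phi>)"
      using w by simp
    from has_vector_derivative_minus[OF this]
    show "((\<lambda>\<phi>. - Im (dilog (of_real \<rho> * cis \<phi>))) has_vector_derivative
        ln (cmod (1 - of_real \<rho> * cis \<phi>))) (at \<phi> within {min 0 \<theta>..max 0 \<theta>})"
      by (simp add: w_def has_vector_derivative_at_within)
  qed (use \<rho> in \<open>rule continuous_on_ln_cmod_one_minus_polar\<close>)
  then show ?thesis
    using Im_dilog_of_real[of \<rho>] \<rho> by (simp add: zero_ereal_def)
qed

text \<open>After subtracting \<open>ln \<rho> / 2\<close>, the function \<open>ln|1 - \<rho> e\<^sup>i\<^sup>\<phi>|\<close> decreases pointwise as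
  \<open>\<rho>\<close> increases to \<open>1\<close>, so that monotone convergence yields both the integrability of
  \<open>ln|2 sin (\<phi>/2)|\<close> and the value of its integral. Here \<open>\<rho> = (n + 1) / (n + 2)\<close>.\<close>

lemma ln_cmod_one_minus_polar:
  fixes n :: nat
  defines "\<rho> \<equiv> (real n + 1) / (real n + 2)"
  shows "ln (cmod (1 - of_real \<rho> * cis \<phi>)) - ln \<rho> / 2
       = ln (1 / ((real n + 1) * (real n + 2)) + 4 * (sin (\<phi> / 2))\<^sup>2) / 2"
proof -
  have \<rho>: "0 < \<rho>" "\<rho> < 1"
    by (auto simp: \<rho>_def)
  have "cmod (of_real \<rho> * cis \<phi>) < 1"
    using \<rho> by (simp add: norm_mult)
  then have pos: "cmod (1 - of_real \<rho> * cis \<phi>) > 0"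
    by auto
  \<comment> \<open>Division by \<open>\<rho>\<close> frees the sine term of \<open>\<rho>\<close>;
    what remains is \<open>(1 - \<rho>)^2 / \<rho>\<close>, which decreases in
    \<open>n\<close>.\<close>
  have "2 * ln (cmod (1 - of_real \<rho> * cis \<phi>)) - ln \<rho> = ln ((cmod (1 - of_real \<rho> * cis \<phi>))\<^sup>2 / \<rho>)"
    using pos \<rho> by (simp add: ln_div ln_realpow)
  also have "(cmod (1 - of_real \<rho> * cis \<phi>))\<^sup>2 / \<rho> = (1 - \<rho>)\<^sup>2 / \<rho> + 4 * (sin (\<phi> / 2))\<^sup>2"
    using \<rho> by (simp add: cmod_one_minus_polar add_divide_distrib)
  also have "1 - \<rho> = 1 / (real n + 2)"
    by (simp add: \<rho>_def field_simps)
  also have "(1 / (real n + 2))\<^sup>2 / \<rho> = 1 / ((real n + 1) * (real n + 2))"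
    by (simp add: \<rho>_def power2_eq_square)
  finally show ?thesis
    by simp
qed

text \<open>The angle may exceed \<open>2 * pi\<close>: the final bounds use it in
  \<open>(2 pi, 3 pi)\<close>, where the range of integration passes the singularity at
  \<open>2 * pi\<close>.\<close>

lemma Im_dilog_cis:
  assumes "0 \<le> \<theta>" "cis \<theta> \<noteq> 1"
  shows "Im (dilog (cis \<theta>)) = clausen \<theta>"
proof -
  define \<rho> where "\<rho> = (\<lambda>n::nat. (real n + 1) / (real n + 2))"
  \<comment> \<open>The outer minus sign turns the decreasing sequence into an increasing one and
    matches the sign in \<open>clausen\<close>.\<close>
  define f where "f = (\<lambda>n \<phi>. - (ln (cmod (1 - of_real (\<rho> n) * cis \<phi>)) - ln (\<rho> n) / 2))"
  define I where "I = {0<..<\<theta>}"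
  have \<rho>: "0 < \<rho> n" "\<rho> n < 1" for n
    by (auto simp: \<rho>_def)
  have lim_\<rho>: "\<rho> \<longlonglongrightarrow> 1"
    unfolding \<rho>_def by real_asymp
  have f_eq: "f n \<phi> = - (ln (1 / ((real n + 1) * (real n + 2)) + 4 * (sin (\<phi> / 2))\<^sup>2) / 2)" for n \<phi>
    unfolding f_def \<rho>_def ln_cmod_one_minus_polar ..
  have cont: "continuous_on A (f n)" for n A
    unfolding f_def using \<rho>[of n]
    by (intro continuous_intros continuous_on_ln_cmod_one_minus_polar) auto
  have lborel_I: "(LBINT \<phi>=0..ereal \<theta>. g \<phi>) = (\<integral>\<phi>. indicator I \<phi> *\<^sub>R g \<phi> \<partial>lborel)" for g :: "real \<Rightarrow> real"
    using assms(1) interval_integral_Ioo[of 0 "ereal \<theta>" g]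
    by (simp add: I_def set_lebesgue_integral_def)
  have int_f: "(\<integral>\<phi>. indicator I \<phi> *\<^sub>R f n \<phi> \<partial>lborel)
      = Im (dilog (of_real (\<rho> n) * cis \<theta>)) + \<theta> * (ln (\<rho> n) / 2)" for n
  proof -
    have "(LBINT \<phi>=ereal 0..ereal \<theta>. f n \<phi>)
        = - ((LBINT \<phi>=ereal 0..ereal \<theta>. ln (cmod (1 - of_real (\<rho> n) * cis \<phi>)))
              - (LBINT \<phi>=ereal 0..ereal \<theta>. ln (\<rho> n) / 2))"
      unfolding f_def interval_lebesgue_integral_uminus
      by (subst interval_lebesgue_integral_diff)
        (use assms(1) \<rho>[of n] in \<open>auto intro!: interval_integrable_continuous_on continuous_on_ln_cmod_one_minus_polar\<close>)
    also have "(LBINT \<phi>=ereal 0..ereal \<theta>. ln (\<rho> n) / 2) = \<theta> * (ln (\<rho> n) / 2)"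
      using assms(1) by (subst interval_integral_const) auto
    finally show ?thesis
      using Im_dilog_eq_integral[OF \<rho> assms(1), of n] by (simp add: lborel_I zero_ereal_def[symmetric])
  qed
  have "(\<integral>\<phi>. indicator I \<phi> *\<^sub>R - ln \<bar>2 * sin (\<phi> / 2)\<bar> \<partial>lborel) = Im (dilog (cis \<theta>))"
  proof (rule integral_monotone_convergence)
    fix n
    have "set_integrable lborel {0..\<theta>} (f n)"
      using borel_integrable_atLeastAtMost'[OF cont] .
    then have "set_integrable lborel I (f n)"
      by (rule set_integrable_subset) (auto simp: I_def)
    then show "integrable lborel (\<lambda>\<phi>. indicator I \<phi> *\<^sub>R f n \<phi>)"
      by (simp add: set_integrable_def)
  next
    have "f m \<phi> \<le> f n \<phi>" if "m \<le> n" for m n \<phi>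
    proof -
      have "1 / ((real n + 1) * (real n + 2)) \<le> 1 / ((real m + 1) * (real m + 2))"
        using that by (intro divide_left_mono mult_mono) auto
      then show ?thesis
        unfolding f_eq by (auto intro!: ln_mono add_pos_nonneg)
    qed
    then show "AE \<phi> in lborel. mono (\<lambda>n. indicator I \<phi> *\<^sub>R f n \<phi>)"
      by (auto simp: mono_def indicator_def)
  next
    \<comment> \<open>At these points \<open>f n \<phi>\<close> tends to infinity while the
      convention \<open>ln 0 = 0\<close> gives the limit function the value 0, so they must form a
      null set.\<close>
    have "countable {\<phi>::real. sin (\<phi> / 2) = 0}"
      by (rule countable_subset[of _ "range (\<lambda>i::int. 2 * (of_int i * pi))"])
        (auto simp: sin_zero_iff_int2)
    then have "AE \<phi>::real in lborel. sin (\<phi> / 2) \<noteq> 0"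
      by (rule AE_I'[OF countable_imp_null_set_lborel]) auto
    then show "AE \<phi> in lborel. (\<lambda>n. indicator I \<phi> *\<^sub>R f n \<phi>) \<longlonglongrightarrow> indicator I \<phi> *\<^sub>R - ln \<bar>2 * sin (\<phi> / 2)\<bar>"
    proof eventually_elim
      case (elim \<phi>)
      have "(\<lambda>n. 1 / ((real n + 1) * (real n + 2))) \<longlonglongrightarrow> 0"
        by real_asymp
      then have "(\<lambda>n. f n \<phi>) \<longlonglongrightarrow> - (ln (0 + 4 * (sin (\<phi> / 2))\<^sup>2) / 2)"
        unfolding f_eq using elim by (intro tendsto_intros) auto
      also have "0 + 4 * (sin (\<phi> / 2))\<^sup>2 = \<bar>2 * sin (\<phi> / 2)\<bar>\<^sup>2"
        by (simp add: power_mult_distrib)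
      also have "ln (\<bar>2 * sin (\<phi> / 2)\<bar>\<^sup>2) / 2 = ln \<bar>2 * sin (\<phi> / 2)\<bar>"
        using elim by (subst ln_realpow) auto
      finally show ?case
        by (intro tendsto_intros)
    qed
  next
    \<comment> \<open>On the unit circle only the point 1 lies on the cut, so the values at
      \<open>\<rho> n * cis \<theta>\<close> converge; the correction
      \<open>\<theta> * ln (\<rho> n) / 2\<close> vanishes in the limit.\<close>
    have "isCont dilog (cis \<theta>)"
      using has_field_derivative_dilog one_minus_notin_nonpos_Reals[of "cis \<theta>"] assms(2)
      by (intro DERIV_isCont) auto
    moreover have "(\<lambda>n. of_real (\<rho> n) * cis \<theta>) \<longlonglongrightarrow> of_real 1 * cis \<theta>"
      by (intro tendsto_intros lim_\<rho>)
    ultimately have "(\<lambda>n. dilog (of_real (\<rho> n) * cis \<theta>)) \<longlonglongrightarrow> dilog (cis \<theta>)"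
      using isCont_tendsto_compose by fastforce
    then have "(\<lambda>n. Im (dilog (of_real (\<rho> n) * cis \<theta>)) + \<theta> * (ln (\<rho> n) / 2))
        \<longlonglongrightarrow> Im (dilog (cis \<theta>)) + \<theta> * (ln 1 / 2)"
      by (intro tendsto_intros lim_\<rho>) auto
    then show "(\<lambda>n. \<integral>\<phi>. indicator I \<phi> *\<^sub>R f n \<phi> \<partial>lborel) \<longlonglongrightarrow> Im (dilog (cis \<theta>))"
      by (simp only: int_f) simp
  next
    show "(\<lambda>\<phi>. indicator I \<phi> *\<^sub>R - ln \<bar>2 * sin (\<phi> / 2)\<bar>) \<in> borel_measurable lborel"
      unfolding I_def by measurable
  qed
  then show ?thesis
    by (simp add: clausen_def lborel_I)
qed

section \<open>The bounds in the strip\<close>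

text \<open>The shift by one period puts the angle into \<open>(0, pi)\<close> for
  \<open>1 < x < 3/2\<close>, as the radial bounds require.\<close>

lemma exp_strip: "exp (2 * of_real pi * \<i> * Complex x y) = of_real (exp (- (2 * pi * y))) * cis (2 * pi * (x - 1))"
proof -
  have "exp (2 * of_real pi * \<i> * Complex x y) = of_real (exp (- (2 * pi * y))) * cis (2 * pi * x)"
    by (simp add: exp_eq_polar)
  also have "cis (2 * pi * x) = cis (2 * pi * (x - 1))"
    by (simp add: complex_eq_iff right_diff_distrib cos_diff sin_diff)
  finally show ?thesis .
qed

text \<open>All terms share the denominator \<open>2 pi \<i> z\<close>, since
  \<open>pi \<i> c / z = - 2 pi^2 c / (2 pi \<i> z)\<close>, here with \<open>c = 13/12 + j\<close>.
  Its reciprocal is \<open>- \<i> * cnj z / (2 pi |z|^2)\<close>.\<close>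

lemma Re_r_eq:
  assumes "z = Complex x y" "z \<noteq> 0"
  defines "w \<equiv> exp (2 * of_real pi * \<i> * z)"
  shows "Re (r z + of_real pi * \<i> * of_real j / z)
       = 1 / (2 * pi * (cmod z)\<^sup>2)
         * (x * Im (dilog w) - y * Re (dilog w) + pi\<^sup>2 * y * (13 / 6 + 2 * j))"
proof -
  have Re_of_real_mult: "Re (of_real c * v) = c * Re v" for c v
    by simp
  have "r z + of_real pi * \<i> * of_real j / z
      = (dilog w - of_real (pi\<^sup>2 * (13 / 6 + 2 * j))) / (2 * of_real pi * \<i> * z)"
    using assms(2) by (simp add: r_def w_def field_simps power2_eq_square)
  also have "\<dots> = of_real (1 / (2 * pi * (cmod z)\<^sup>2))
      * (- \<i> * cnj z * (dilog w - of_real (pi\<^sup>2 * (13 / 6 + 2 * j))))"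
  proof -
    have "complex_of_real (1 / (2 * pi * (cmod z)\<^sup>2)) = 1 / (2 * of_real pi * (z * cnj z))"
      unfolding complex_norm_square[symmetric] by simp
    then show ?thesis
      using assms(2) by (simp add: field_simps)
  qed
  finally have "Re (r z + of_real pi * \<i> * of_real j / z) = 1 / (2 * pi * (cmod z)\<^sup>2)
      * Re (- \<i> * cnj z * (dilog w - of_real (pi\<^sup>2 * (13 / 6 + 2 * j))))"
    using Re_of_real_mult by presburger
  also have "Re (- \<i> * cnj z * (dilog w - of_real (pi\<^sup>2 * (13 / 6 + 2 * j))))
      = x * Im (dilog w) - y * Re (dilog w) + pi\<^sup>2 * y * (13 / 6 + 2 * j)"
    by (simp add: assms(1) algebra_simps)
  finally show ?thesis .
qed

theorem theorem4p10:
  shows "r holomorphic_on {z. 1 < Re z \<and> Re z < 3/2} \<and>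
    (\<forall>(z::complex) (x::real) (y::real) (j::real).
       z = Complex x y \<and> 1 < x \<and> x < 3/2 \<longrightarrow>
       (y \<ge> 0 \<longrightarrow>
          Re (r z + of_real pi * \<i> * of_real j / z)
            \<le> 1 / (2 * pi * (cmod z)\<^sup>2)
               * (x * clausen (2 * pi * x) + pi\<^sup>2 * \<bar>y\<bar> * (1/3 + 2 * (j + 1)))) \<and>
       (y \<le> 0 \<longrightarrow>
          Re (r z + of_real pi * \<i> * of_real j / z)
            \<le> 1 / (2 * pi * (cmod z)\<^sup>2)
               * (x * clausen (2 * pi * x) + pi\<^sup>2 * \<bar>y\<bar> * (1/3 - 2 * j))))"
proof (intro conjI allI impI; (elim conjE)?)
  have "1 - exp (2 * of_real pi * \<i> * z) \<notin> \<real>\<^sub>\<le>\<^sub>0" if "1 < Re z" "Re z < 3 / 2" for z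
    using one_minus_polar_notin_nonpos_Reals[of "2 * pi * (Re z - 1)" "exp (- (2 * pi * Im z))"] that
      exp_strip[of "Re z" "Im z"] by (simp add: field_simps)
  then show "r holomorphic_on {z. 1 < Re z \<and> Re z < 3/2}"
    unfolding r_def by (intro holomorphic_intros) auto
next
  fix z x y j
  assume z: "z = Complex x y" and x: "1 < x" "x < 3 / 2"
  define \<theta> where "\<theta> = 2 * pi * (x - 1)"
  define t where "t = exp (- (2 * pi * y))"
  define D where "D = dilog (of_real t * cis \<theta>)"
  have \<theta>: "0 < \<theta>" "\<theta> < pi"
    using x by (auto simp: \<theta>_def field_simps)
  have "z \<noteq> 0"
    using z x by (auto simp: complex_eq_iff)
  have pi: "9 < pi\<^sup>2"
    using power_strict_mono[OF pi_gt3, of 2] by simp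
  \<comment> \<open>The same point of the circle is reached at the angle \<open>2 * pi * x\<close>,
    where the statement evaluates \<open>clausen\<close>.\<close>
  have "cis \<theta> = cis (2 * pi * x)"
    by (simp add: \<theta>_def complex_eq_iff right_diff_distrib cos_diff sin_diff)
  moreover have "cis \<theta> \<noteq> 1"
    using sin_gt_zero[OF \<theta>] by (auto simp: complex_eq_iff)
  ultimately have cl: "Im (dilog (cis \<theta>)) = clausen (2 * pi * x)"
    using Im_dilog_cis[of "2 * pi * x"] x by simp
  note Re_r = Re_r_eq[OF z \<open>z \<noteq> 0\<close>, of j, unfolded z exp_strip, folded z \<theta>_def t_def D_def]
  have le: "1 / (2 * pi * (cmod z)\<^sup>2) * a \<le> 1 / (2 * pi * (cmod z)\<^sup>2) * b" if "a \<le> b" for a b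
    using that by (intro mult_left_mono) auto
  {
    assume y: "0 \<le> y"
    then have t: "0 \<le> t" "t \<le> 1"
      by (auto simp: t_def)
    have "x * Im D \<le> x * clausen (2 * pi * x)"
      using Im_dilog_radial_mono[OF \<theta> t] x cl by (simp add: D_def)
    \<comment> \<open>The allowance 1/6 is what \<open>13/6 + 1/6 = 1/3 + 2\<close> leaves; here
      \<open>- Re D \<le> t \<le> 1\<close>.\<close>
    moreover have "- Re D \<le> pi\<^sup>2 / 6"
      using Re_dilog_radial_ge[OF \<theta> t(1)] t pi by (simp add: D_def)
    then have "y * (- Re D) \<le> y * (pi\<^sup>2 / 6)"
      using y by (rule mult_left_mono)
    ultimately show "Re (r z + of_real pi * \<i> * of_real j / z)
            \<le> 1 / (2 * pi * (cmod z)\<^sup>2)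
               * (x * clausen (2 * pi * x) + pi\<^sup>2 * \<bar>y\<bar> * (1/3 + 2 * (j + 1)))"
      unfolding Re_r using y by (intro le) (simp add: algebra_simps)
  }
  {
    assume y: "y \<le> 0"
    then have t: "1 \<le> t" "ln t = - (2 * pi * y)"
      by (auto simp: t_def mult_nonneg_nonpos)
    have "x * Im D \<le> x * (clausen (2 * pi * x) + (pi - \<theta>) * ln t)"
      using Im_dilog_radial_le[OF \<theta> t(1)] x cl by (simp add: D_def)
    also have "\<dots> = x * clausen (2 * pi * x) + (- y) * (pi\<^sup>2 * (6 * x - 4 * x\<^sup>2))"
      by (simp add: t(2) \<theta>_def power2_eq_square algebra_simps)
    finally have "x * Im D \<le> x * clausen (2 * pi * x) + (- y) * (pi\<^sup>2 * (6 * x - 4 * x\<^sup>2))" .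
    \<comment> \<open>The target 5/2 comes from \<open>5/2 - 13/6 = 1/3\<close>. The polynomial uses
      2 of it, by the factorization of \<open>4 x^2 - 6 x + 2\<close>, and
      \<open>Re D \<le> 3\<close> fits into the remaining \<open>pi^2 / 2\<close>.\<close>
    moreover have "pi\<^sup>2 * (6 * x - 4 * x\<^sup>2) + Re D \<le> pi\<^sup>2 * (5 / 2)"
    proof -
      have "0 \<le> (4 * x - 2) * (x - 1)"
        using x by simp
      then have "6 * x - 4 * x\<^sup>2 \<le> 2"
        by (simp add: power2_eq_square algebra_simps)
      then have "pi\<^sup>2 * (6 * x - 4 * x\<^sup>2) \<le> pi\<^sup>2 * 2"
        by (rule mult_left_mono) simp
      moreover have "Re D \<le> 3"
        using Re_dilog_radial_le[OF \<theta> t(1)] by (simp add: D_def)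
      ultimately show ?thesis
        using pi by linarith
    qed
    then have "(- y) * (pi\<^sup>2 * (6 * x - 4 * x\<^sup>2) + Re D) \<le> (- y) * (pi\<^sup>2 * (5 / 2))"
      using y by (intro mult_left_mono) auto
    ultimately show "Re (r z + of_real pi * \<i> * of_real j / z)
            \<le> 1 / (2 * pi * (cmod z)\<^sup>2)
               * (x * clausen (2 * pi * x) + pi\<^sup>2 * \<bar>y\<bar> * (1/3 - 2 * j))"
      unfolding Re_r using y by (intro le) (simp add: algebra_simps)
  }
qed

end
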